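(* For $N\in\mathbb{N}=\{1,2,\dots\}$ let $$F_N(\beta)=\beta^6-(N+3)\beta^5+(3N+1)\beta^4-2(N-1)\beta^3-(N+2)\beta^2+N-1,$$ and let $\beta_N>N$ be the unique solution of $F_N(\beta)=0$ with $\beta>N$. Then $$\lim_{N\to\infty}\frac{\beta_N}{N}=1.$$
   Context: The variable $\beta$ is real. Existence and uniqueness of a real root $\beta_N>N$ of $F_N$ is part of the setting. *)

theory Defs
  imports "HOL-Analysis.Analysis"
begin

definition F_poly :: "nat \<Rightarrow> real \<Rightarrow> real" where
  "F_poly N b = b ^ 6 - (real N + 3) * b ^ 5 + (3 * real N + 1) * b ^ 4
           - 2 * (real N - 1) * b ^ 3 - (real N + 2) * b ^ 2 + real N - 1"

(* Meaningful only for N \<ge> 1, where lemma ex1_root below shows it is well defined. *)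
definition beta :: "nat \<Rightarrow> real" where
  "beta N = (THE b. b > real N \<and> F_poly N b = 0)"

(* F_poly N b = (b - N) * rootP b - rootQ b with rootP, rootQ > 0 for b > 1, and b - rootQ b / rootP b is strictly increasing. *)
definition rootP :: "real \<Rightarrow> real" where "rootP b = b ^ 5 - 3 * b ^ 4 + 2 * b ^ 3 + b ^ 2 - 1"
definition rootQ :: "real \<Rightarrow> real" where "rootQ b = b ^ 4 - b ^ 3 + 2 * b ^ 2 - b + 1"

lemma F_poly_eq: "F_poly N b = (b - real N) * rootP b - rootQ b"
  unfolding F_poly_def rootP_def rootQ_def by algebra

lemma P_pos: assumes "b > 1" shows "rootP b > 0"
proof -
  have "rootP b = (b - 1) * ((b\<^sup>2 - b - 1/2)\<^sup>2 + 3/4)"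
    unfolding rootP_def by (simp add: power2_eq_square eval_nat_numeral algebra_simps)
  moreover have "(b\<^sup>2 - b - 1/2)\<^sup>2 + 3/4 > 0"
    by (intro add_nonneg_pos) auto
  ultimately show ?thesis using assms by simp
qed

lemma Q_pos: assumes "b \<ge> 1" shows "rootQ b > 0"
proof -
  have "rootQ b = (b\<^sup>2 + 1) * (b * (b - 1) + 1)"
    unfolding rootQ_def by (simp add: power2_eq_square eval_nat_numeral algebra_simps)
  moreover have "b\<^sup>2 + 1 > 0" "b * (b - 1) + 1 > 0"
    using assms by (auto intro: add_nonneg_pos)
  ultimately show ?thesis by simp
qed

lemma deriv_pos:
  assumes "b > 1"
  shows "(5*b^4 - 12*b^3 + 6*b^2 + 2*b) * rootQ b - rootP b * (4*b^3 - 3*b^2 + 4*b - 1) > 0"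
proof -
  define s where "s = b - 1"
  have s: "s > 0" and b: "b = s + 1" using assms by (auto simp: s_def)
  have "(5*b^4 - 12*b^3 + 6*b^2 + 2*b) * rootQ b - rootP b * (4*b^3 - 3*b^2 + 4*b - 1)
      = s^8 + 6 * s^7 + 21 * s^6 + 38 * s^5 + 19/10 * (1 - 20/19 * s - 3 * s^2)^2
        + s^2 * (56/190 - 2 * s + 169/10 * s^2) + 1/10"
    unfolding b rootP_def rootQ_def by (simp add: field_simps) algebra
  moreover have "56/190 - 2 * s + 169/10 * s^2 = (2 * s - 1/2)^2 + 129/10 * s^2 + 17/380"
    by (simp add: power2_eq_square algebra_simps)
  ultimately show ?thesis using s by (simp add: add_nonneg_pos add_pos_nonneg)
qed

lemma root_unique_aux:
  assumes "1 < x" "x < y"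
  shows "x - rootQ x / rootP x < y - rootQ y / rootP y"
proof (rule DERIV_pos_imp_increasing[OF assms(2)])
  fix b assume "x \<le> b" "b \<le> y"
  hence b: "b > 1" using assms by simp
  have P: "rootP b > 0" by (rule P_pos[OF b])
  let ?P' = "5*b^4 - 12*b^3 + 6*b^2 + 2*b" and ?Q' = "4*b^3 - 3*b^2 + 4*b - 1"
  have dP: "(rootP has_real_derivative ?P') (at b)"
    unfolding rootP_def by (auto intro!: derivative_eq_intros simp: algebra_simps)
  have dQ: "(rootQ has_real_derivative ?Q') (at b)"
    unfolding rootQ_def by (auto intro!: derivative_eq_intros simp: algebra_simps)
  have "((\<lambda>b. b - rootQ b / rootP b) has_real_derivative (1 - (?Q' * rootP b - rootQ b * ?P') / (rootP b * rootP b))) (at b)"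
    using P by (intro DERIV_diff DERIV_ident DERIV_divide dP dQ) auto
  moreover have "(?Q' * rootP b - rootQ b * ?P') / (rootP b * rootP b) < 0"
    using deriv_pos[OF b] P by (intro divide_neg_pos) (auto simp: mult.commute)
  ultimately show "\<exists>D. ((\<lambda>b. b - rootQ b / rootP b) has_real_derivative D) (at b) \<and> 0 < D"
    by (intro exI[of _ "1 - (?Q' * rootP b - rootQ b * ?P') / (rootP b * rootP b)"] conjI) (assumption, linarith)
qed

lemma ex1_root:
  assumes "N \<ge> 1"
  shows "\<exists>!b. b > real N \<and> F_poly N b = 0"
proof (rule ex_ex1I)
  have neg: "F_poly N (real N) < 0" using Q_pos[of "real N"] assms by (simp add: F_poly_eq)
  have pos: "F_poly N (real N + 4) > 0"
  proof -
    define s where "s = real N + 3"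
    have s: "s \<ge> 4" using assms by (simp add: s_def)
    have "F_poly N (real N + 4) = 4 * s^5 + 7 * s^4 - 3 * s^3 - 9 * s^2 - 2"
      unfolding F_poly_eq rootP_def rootQ_def s_def by algebra
    also have "\<dots> = s^4 * (s - 3) + s^2 * (s - 3) * (3 * s^2 + 19 * s + 54) + (153 * s^2 - 2)"
      by (simp add: eval_nat_numeral algebra_simps)
    also have "\<dots> > 0"
    proof -
      have "s^2 \<ge> 4^2" using s by (intro power_mono) auto
      thus ?thesis using s by (intro add_nonneg_pos add_nonneg_nonneg mult_nonneg_nonneg) auto
    qed
    finally show ?thesis .
  qed
  have "\<exists>b\<ge>real N. b \<le> real N + 4 \<and> F_poly N b = 0"
    using neg pos by (intro IVT') (auto simp: F_poly_def intro!: continuous_intros)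
  then show "\<exists>b. b > real N \<and> F_poly N b = 0"
    using neg by (auto simp: less_le)
next
  fix x y assume x: "x > real N \<and> F_poly N x = 0" and y: "y > real N \<and> F_poly N y = 0"
  have *: "z > 1 \<and> z - rootQ z / rootP z = real N" if "z > real N \<and> F_poly N z = 0" for z
  proof -
    have z: "z > 1" using that assms by linarith
    show ?thesis using that P_pos[OF z] z by (simp add: F_poly_eq field_simps)
  qed
  show "x = y"
    using *[OF x] *[OF y] root_unique_aux[of x y] root_unique_aux[of y x]
    by (cases x y rule: linorder_cases) auto
qed

end

theory Submission
  imports Defs
begin

text \<open>
  Writing \<open>F\<^sub>N(b) = (b - N) P(b) - Q(b)\<close> with \<open>P\<close> of degree 5 and \<open>Q\<close> of degree 4, the root satisfies
  \<open>\<beta>\<^sub>N - N = Q(\<beta>\<^sub>N) / P(\<beta>\<^sub>N)\<close>. The degrees make this quotient small for large arguments; it is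
  enough that \<open>Q < P\<close> on \<open>[4, \<infinity>)\<close> (\<open>rootQ_less_rootP\<close>), because this gives
  \<open>N < \<beta>\<^sub>N < N + 1\<close> for \<open>N \<ge> 4\<close>, and dividing by \<open>N\<close> squeezes the ratio to 1.
\<close>

lemma rootQ_less_rootP:
  assumes "b \<ge> 4"
  shows "rootQ b < rootP b"
proof -
  have "rootP b - rootQ b = b ^ 4 * (b - 4) + b\<^sup>2 * (3 * b - 1) + (b - 2)"
    unfolding rootP_def rootQ_def by (simp add: eval_nat_numeral algebra_simps)
  also have "\<dots> > 0"
    using assms by (intro add_nonneg_pos add_nonneg_nonneg mult_nonneg_nonneg) auto
  finally show ?thesis by simp
qed

lemma beta_root:
  assumes "N \<ge> 1"
  shows "beta N > real N" and "F_poly N (beta N) = 0"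
  using theI'[OF ex1_root[OF assms]] unfolding beta_def by simp_all

lemma beta_less_Suc:
  assumes "N \<ge> 4"
  shows "beta N < real N + 1"
proof -
  have gt: "beta N > real N" and root: "F_poly N (beta N) = 0"
    using beta_root[of N] assms by auto
  have "rootP (beta N) > 0" using gt assms by (intro P_pos) linarith
  moreover have "(beta N - real N) * rootP (beta N) < 1 * rootP (beta N)"
    using root rootQ_less_rootP[of "beta N"] gt assms by (simp add: F_poly_eq)
  ultimately have "beta N - real N < 1" using mult_less_cancel_right_pos by blast
  then show ?thesis by simp
qed

theorem proposition5p16:
  shows "(\<lambda>N. beta N / real N) \<longlonglongrightarrow> 1"
proof (rule tendsto_sandwich)
  show "\<forall>\<^sub>F N in sequentially. 1 \<le> beta N / real N"
    using eventually_ge_at_top[of 1]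
    by eventually_elim (use beta_root(1) in \<open>simp add: less_imp_le\<close>)
  show "\<forall>\<^sub>F N in sequentially. beta N / real N \<le> 1 + inverse (real N)"
    using eventually_ge_at_top[of 4]
  proof eventually_elim
    case (elim N)
    then show ?case using beta_less_Suc[OF elim] by (simp add: field_simps)
  qed
  show "(\<lambda>N. 1 + inverse (real N)) \<longlonglongrightarrow> 1"
    using tendsto_add[OF tendsto_const[of "1::real"] lim_inverse_n] by simp
qed (rule tendsto_const)

end
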